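(* As polynomials in $x$ and $y$ with coefficients in the group algebra of $\mathfrak{B}_n$, $$\phi_A(x/2)\,\phi_B((y-1)/2)=\phi_A(xy/2)$$ and $$\phi_B((x-1)/2)\,\phi_A(y/2)=\phi_A(xy/2).$$
   Context: Let $n\ge 1$. The hyperoctahedral group $\mathfrak{B}_n$ is the group (under composition of functions, $(\sigma\tau)(i)=\sigma(\tau(i))$) of all bijections $\pi$ of $\{-n,\ldots,-1,0,1,\ldots,n\}$ with $\pi(-i)=-\pi(i)$ for all $i$. For $\pi\in\mathfrak{B}_n$, $\mathrm{des}_A(\pi)=|\{i\in\{1,\ldots,n-1\}:\pi(i)>\pi(i+1)\}|$ and $\mathrm{des}_B(\pi)=|\{i\in\{0,\ldots,n-1\}:\pi(i)>\pi(i+1)\}|$ (with $\pi(0)=0$). Define $$\phi_A(x)=\sum_{\pi\in\mathfrak{B}_n}\binom{x+n-1-\mathrm{des}_A(\pi)}{n}\pi,\qquad \phi_B(x)=\sum_{\pi\in\mathfrak{B}_n}\binom{x+n-\mathrm{des}_B(\pi)}{n}\pi,$$ polynomials in $x$ with coefficients in $\mathbb{Q}[\mathfrak{B}_n]$, where $\binom{z}{n}=z(z-1)\cdots(z-n+1)/n!$. *)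

theory Defs
  imports
    Complex_Main
    "HOL-Computational_Algebra.Polynomial"
    "HOL-Combinatorics.Permutations"
    "HOL-Combinatorics.Perm"
    "HOL-Library.Poly_Mapping"
    "HOL-Library.Product_Plus"
begin

unbundle permutation_syntax

text \<open>
  A permutation of \<open>{-n..n}\<close> is represented, as usual with \<open>permutes\<close>, by its extension to the
  integers that fixes all other points.  Multiplication in \<^typ>\<open>int perm\<close> is composition of
  functions, \<open>(\<sigma> * \<tau>) \<langle>$\<rangle> i = \<sigma> \<langle>$\<rangle> (\<tau> \<langle>$\<rangle> i)\<close>.
\<close>

definition hyperoctahedral :: "nat \<Rightarrow> int perm set" where
  "hyperoctahedral n =
    {\<pi>. apply \<pi> permutes {- int n..int n} \<and> (\<forall>i\<in>{- int n..int n}. \<pi> \<langle>$\<rangle> (- i) = - (\<pi> \<langle>$\<rangle> i))}"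

definition des_A :: "nat \<Rightarrow> int perm \<Rightarrow> nat" where
  "des_A n \<pi> = card {i \<in> {1..int n - 1}. \<pi> \<langle>$\<rangle> i > \<pi> \<langle>$\<rangle> (i + 1)}"

definition des_B :: "nat \<Rightarrow> int perm \<Rightarrow> nat" where
  "des_B n \<pi> = card {i \<in> {0..int n - 1}. \<pi> \<langle>$\<rangle> i > \<pi> \<langle>$\<rangle> (i + 1)}"

lemma hyperoctahedral_one: "1 \<in> hyperoctahedral n"
  by (simp add: hyperoctahedral_def permutes_id)

lemma hyperoctahedral_times:
  assumes "\<sigma> \<in> hyperoctahedral n" "\<tau> \<in> hyperoctahedral n"
  shows "\<sigma> * \<tau> \<in> hyperoctahedral n"
proof -
  let ?I = "{- int n..int n}"
  have \<sigma>: "apply \<sigma> permutes ?I" "\<And>i. i \<in> ?I \<Longrightarrow> \<sigma> \<langle>$\<rangle> (- i) = - (\<sigma> \<langle>$\<rangle> i)"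
    and \<tau>: "apply \<tau> permutes ?I" "\<And>i. i \<in> ?I \<Longrightarrow> \<tau> \<langle>$\<rangle> (- i) = - (\<tau> \<langle>$\<rangle> i)"
    using assms unfolding hyperoctahedral_def by blast+
  have perm: "apply (\<sigma> * \<tau>) permutes ?I"
    unfolding apply_times by (rule permutes_compose[OF \<tau>(1) \<sigma>(1)])
  have odd: "(\<sigma> * \<tau>) \<langle>$\<rangle> (- i) = - ((\<sigma> * \<tau>) \<langle>$\<rangle> i)" if i: "i \<in> ?I" for i
  proof -
    have "\<tau> \<langle>$\<rangle> i \<in> ?I"
      by (subst permutes_in_image[OF \<tau>(1)]) (fact i)
    then show ?thesis
      unfolding apply_times o_def \<tau>(2)[OF i] by (rule \<sigma>(2))
  qed
  show ?thesis
    using perm odd unfolding hyperoctahedral_def by blast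
qed

text \<open>
  Convolution on \<open>'g \<Rightarrow>\<^sub>0 'r\<close> is indexed by an additively written monoid of exponents.  To obtain
  the algebra of a multiplicatively written monoid, its product is transported to \<open>+\<close>
  (which is not assumed to be commutative).
\<close>

datatype 'a additive = Additive 'a

instantiation additive :: (monoid_mult) monoid_add
begin

definition zero_additive :: "'a additive" where
  "0 = Additive 1"

fun plus_additive :: "'a additive \<Rightarrow> 'a additive \<Rightarrow> 'a additive" where
  "Additive g + Additive h = Additive (g * h)"

instance
proof
  fix a b c :: "'a additive"
  show "a + b + c = a + (b + c)"
    by (cases a; cases b; cases c) (simp add: mult.assoc)
  show "0 + a = a" "a + 0 = a"
    by (cases a; simp add: zero_additive_def)+
qed

end

text \<open>
  The rational group algebra of the finitely supported permutations of the integers; it contains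
  the group algebra of \<^term>\<open>hyperoctahedral n\<close> for every \<open>n\<close>.
\<close>

type_synonym perm_algebra = "int perm additive \<Rightarrow>\<^sub>0 rat"

abbreviation alg_scalar :: "rat \<Rightarrow> perm_algebra" where
  "alg_scalar c \<equiv> Poly_Mapping.single 0 c"

text \<open>
  \<^typ>\<open>'a poly\<close> requires commutative coefficients for its ring structure, so polynomials over the
  group algebra are finitely supported families of coefficients, indexed by the exponent of \<open>x\<close>
  or by the pair of exponents of \<open>x\<close> and \<open>y\<close>.  The indeterminates commute with the coefficients.
\<close>

type_synonym perm_poly = "nat \<Rightarrow>\<^sub>0 perm_algebra"

type_synonym perm_poly2 = "nat \<times> nat \<Rightarrow>\<^sub>0 perm_algebra"

definition indet_x :: perm_poly2 where
  "indet_x = Poly_Mapping.single (1, 0) 1"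

definition indet_y :: perm_poly2 where
  "indet_y = Poly_Mapping.single (0, 1) 1"

definition const2 :: "perm_algebra \<Rightarrow> perm_poly2" where
  "const2 a = Poly_Mapping.single (0, 0) a"

definition half :: perm_poly2 where
  "half = const2 (alg_scalar (1 / 2))"

definition subst2 :: "perm_poly \<Rightarrow> perm_poly2 \<Rightarrow> perm_poly2" where
  "subst2 p z = (\<Sum>k\<in>Poly_Mapping.keys p. const2 (Poly_Mapping.lookup p k) * z ^ k)"

text \<open>The rational polynomial \<open>z (z - 1) \<dots> (z - n + 1) / n!\<close>.\<close>

definition binom_poly :: "rat poly \<Rightarrow> nat \<Rightarrow> rat poly" where
  "binom_poly z n = smult (1 / fact n) (\<Prod>i<n. z - of_nat i)"

text \<open>The polynomial \<open>p(x) \<pi>\<close>.\<close>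

definition poly_times_perm :: "rat poly \<Rightarrow> int perm \<Rightarrow> perm_poly" where
  "poly_times_perm p \<pi> =
    (\<Sum>k\<le>degree p. Poly_Mapping.single k (Poly_Mapping.single (Additive \<pi>) (coeff p k)))"

text \<open>Here \<open>[:a, 1:]\<close> is \<open>x + a\<close>; the subtractions take place in \<^typ>\<open>rat\<close>.\<close>

definition phi_A :: "nat \<Rightarrow> perm_poly" where
  "phi_A n = (\<Sum>\<pi>\<in>hyperoctahedral n.
    poly_times_perm (binom_poly [:of_nat n - 1 - of_nat (des_A n \<pi>), 1:] n) \<pi>)"

definition phi_B :: "nat \<Rightarrow> perm_poly" where
  "phi_B n = (\<Sum>\<pi>\<in>hyperoctahedral n.
    poly_times_perm (binom_poly [:of_nat n - of_nat (des_B n \<pi>), 1:] n) \<pi>)"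

lemma finite_hyperoctahedral: "finite (hyperoctahedral n)"
proof -
  have "finite (apply ` hyperoctahedral n)"
    by (rule finite_subset[OF _ finite_permutations[of "{- int n..int n}"]])
      (auto simp: hyperoctahedral_def)
  moreover have "inj_on apply (hyperoctahedral n)"
    by (auto intro!: inj_onI simp: apply_inject)
  ultimately show ?thesis
    by (rule finite_imageD)
qed

end

theory Submission
  imports Defs
begin

text \<open>
  Let \<open>X\<^sub>x\<close> be the set of \<open>x\<close> integers \<open>1 - x, 3 - x, \<dots>, x - 1\<close>, and sort every odd function
  \<open>f\<close> on \<open>{-n..n}\<close> with values in \<open>X\<^sub>x\<close> (outside 0): there is a unique signed permutation along
  which the pairs \<open>(f i, i)\<close> increase lexicographically.  Let \<open>\<Phi>(x)\<close> be the sum of these signed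
  permutations in the group algebra.  Counting the words sorted by a given \<open>\<pi>\<close> gives
  \<open>\<Phi>(2 j) = \<phi>\<^sub>A(j)\<close> and \<open>\<Phi>(2 k + 1) = \<phi>\<^sub>B(k)\<close>.  If \<open>f\<close> is sorted by \<open>\<sigma>\<close> and \<open>g\<close> by \<open>\<tau>\<close>, then
  \<open>x g(\<sigma>\<^sup>-\<^sup>1 i) + f(i)\<close> is sorted by \<open>\<sigma> \<tau>\<close>, and since every letter of \<open>X\<^bsub>xy\<^esub>\<close> is uniquely
  \<open>x b + a\<close> with \<open>b\<close> in \<open>X\<^sub>y\<close> and \<open>a\<close> in \<open>X\<^sub>x\<close>, this is a bijection, so \<open>\<Phi>(x) \<Phi>(y) = \<Phi>(x y)\<close>.
  The polynomial identities hold at infinitely many \<open>x\<close> for each of infinitely many \<open>y\<close>.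
\<close>

subsection \<open>Evaluating polynomials over the group algebra\<close>

text \<open>The weight \<open>w k\<close> is the value given to the monomial with exponent
  \<open>k\<close>. Leaving the type of exponents open lets the same lemmas serve polynomials in one
  and in two variables.\<close>

definition eval_with :: "('m \<Rightarrow> 'r) \<Rightarrow> ('m \<Rightarrow>\<^sub>0 'r::ring_1) \<Rightarrow> 'r" where
  "eval_with w p = (\<Sum>k\<in>Poly_Mapping.keys p. Poly_Mapping.lookup p k * w k)"

lemma eval_with_superset:
  assumes "finite K" "Poly_Mapping.keys p \<subseteq> K"
  shows "eval_with w p = (\<Sum>k\<in>K. Poly_Mapping.lookup p k * w k)"
  unfolding eval_with_def using assms
  by (intro sum.mono_neutral_left) (auto simp: in_keys_iff)

lemma eval_with_zero [simp]: "eval_with w 0 = 0"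
  by (simp add: eval_with_def)

lemma eval_with_single [simp]: "eval_with w (Poly_Mapping.single k a) = a * w k"
  by (simp add: eval_with_def)

lemma eval_with_add: "eval_with w (p + q) = eval_with w p + eval_with w q"
proof -
  let ?K = "Poly_Mapping.keys p \<union> Poly_Mapping.keys q"
  have "eval_with w r = (\<Sum>k\<in>?K. Poly_Mapping.lookup r k * w k)"
    if "Poly_Mapping.keys r \<subseteq> ?K" for r
    using that by (intro eval_with_superset) auto
  then show ?thesis
    using keys_add[of p q] by (simp add: lookup_add distrib_right sum.distrib)
qed

lemma eval_with_sum: "eval_with w (\<Sum>i\<in>A. p i) = (\<Sum>i\<in>A. eval_with w (p i))"
  by (induction A rule: infinite_finite_induct) (simp_all add: eval_with_add)

lemma eval_with_diff: "eval_with w (p - q) = eval_with w p - eval_with w q"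
  using eval_with_add[of w "p - q" q] by simp

lemma poly_mapping_sum_single:
  "(\<Sum>k\<in>Poly_Mapping.keys p. Poly_Mapping.single k (Poly_Mapping.lookup p k)) = p"
  by (rule poly_mapping_eqI)
    (auto simp: lookup_sum lookup_single when_def in_keys_iff)

lemma sum_single:
  "(\<Sum>i\<in>A. Poly_Mapping.single k (h i)) = Poly_Mapping.single k (\<Sum>i\<in>A. h i)"
  by (induction A rule: infinite_finite_induct) (simp_all add: single_add)

text \<open>The coefficient ring is noncommutative, so moving \<open>w k\<close> past the
  coefficients of \<open>q\<close> needs central weights; multiplicativity of \<open>w\<close> then
  matches the product of monomials.\<close>

lemma eval_with_mult:
  fixes w :: "'m::monoid_add \<Rightarrow> 'r::ring_1"
  assumes hom: "\<And>k l. w (k + l) = w k * w l"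
    and central: "\<And>k a. w k * a = a * w k"
  shows "eval_with w (p * q) = eval_with w p * eval_with w q"
proof -
  let ?p = "Poly_Mapping.lookup p" and ?q = "Poly_Mapping.lookup q"
  have "p * q = (\<Sum>k\<in>Poly_Mapping.keys p. \<Sum>l\<in>Poly_Mapping.keys q.
      Poly_Mapping.single (k + l) (?p k * ?q l))"
  proof -
    have "p * q = (\<Sum>k\<in>Poly_Mapping.keys p. Poly_Mapping.single k (?p k)) *
        (\<Sum>l\<in>Poly_Mapping.keys q. Poly_Mapping.single l (?q l))"
      by (simp only: poly_mapping_sum_single)
    then show ?thesis
      by (simp only: sum_product mult_single)
  qed
  moreover have "?p k * ?q l * w (k + l) = ?p k * w k * (?q l * w l)" for k l
    unfolding hom by (metis central mult.assoc)
  ultimately show ?thesis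
    by (simp add: eval_with_sum eval_with_def[of _ p] eval_with_def[of _ q] sum_product)
qed

lemma eval_with_power:
  fixes w :: "'m::monoid_add \<Rightarrow> 'r::ring_1"
  assumes "\<And>k l. w (k + l) = w k * w l" "\<And>k a. w k * a = a * w k" "w 0 = 1"
  shows "eval_with w (p ^ k) = eval_with w p ^ k"
proof (induction k)
  case 0
  have "eval_with w (Poly_Mapping.single 0 1) = 1"
    by (simp only: eval_with_single assms mult_1)
  then show ?case by simp
next
  case (Suc k)
  then show ?case by (simp add: eval_with_mult[OF assms(1,2)])
qed

lemma alg_scalar_mult: "alg_scalar a * alg_scalar b = alg_scalar (a * b)"
  by (simp add: mult_single)

lemma alg_scalar_power: "alg_scalar a ^ k = alg_scalar (a ^ k)"
  by (induction k) (simp_all add: alg_scalar_mult)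

text \<open>By linearity it suffices to commute with a single group element, where the exponent
  \<open>0\<close> is neutral on both sides and the rational factors commute.\<close>

lemma alg_scalar_central: "alg_scalar c * a = a * alg_scalar c"
proof -
  have "Poly_Mapping.single 0 c * Poly_Mapping.single k b =
      Poly_Mapping.single k b * Poly_Mapping.single 0 c" for k :: "int perm additive" and b
    by (simp add: mult_single mult.commute)
  then have "alg_scalar c * (\<Sum>k\<in>Poly_Mapping.keys a. Poly_Mapping.single k (Poly_Mapping.lookup a k)) =
      (\<Sum>k\<in>Poly_Mapping.keys a. Poly_Mapping.single k (Poly_Mapping.lookup a k)) * alg_scalar c"
    by (simp only: sum_distrib_left sum_distrib_right)
  then show ?thesis
    by (simp only: poly_mapping_sum_single)
qed

definition eval2 :: "rat \<Rightarrow> rat \<Rightarrow> perm_poly2 \<Rightarrow> perm_algebra" where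
  "eval2 s t = eval_with (\<lambda>k. alg_scalar (s ^ fst k * t ^ snd k))"

lemma eval2_mult: "eval2 s t (p * q) = eval2 s t p * eval2 s t q"
  unfolding eval2_def
  by (rule eval_with_mult[OF _ alg_scalar_central]) (simp add: alg_scalar_mult power_add mult_ac)

lemma eval2_power: "eval2 s t (p ^ k) = eval2 s t p ^ k"
  unfolding eval2_def
  by (rule eval_with_power[OF _ alg_scalar_central]) (simp_all add: alg_scalar_mult power_add mult_ac)

lemma eval2_const2 [simp]: "eval2 s t (const2 a) = a"
  by (simp add: eval2_def const2_def)

lemma eval2_indet_x [simp]: "eval2 s t indet_x = alg_scalar s"
  by (simp add: eval2_def indet_x_def)

lemma eval2_indet_y [simp]: "eval2 s t indet_y = alg_scalar t"
  by (simp add: eval2_def indet_y_def)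

lemma eval2_one [simp]: "eval2 s t 1 = 1"
  using eval2_power[of s t 0 0] by simp

lemma eval2_subst2:
  assumes "eval2 s t z = alg_scalar c"
  shows "eval2 s t (subst2 p z) = eval_with (\<lambda>k. alg_scalar (c ^ k)) p"
proof -
  have "eval2 s t (subst2 p z) =
      (\<Sum>k\<in>Poly_Mapping.keys p. eval2 s t (const2 (Poly_Mapping.lookup p k) * z ^ k))"
    by (simp add: subst2_def eval2_def eval_with_sum)
  also have "\<dots> = eval_with (\<lambda>k. alg_scalar (c ^ k)) p"
    by (simp add: eval2_mult eval2_power assms alg_scalar_power eval_with_def)
  finally show ?thesis .
qed

section \<open>Polynomial identities from values on an infinite grid\<close>

lemma finite_sum_powers_eq_zero:
  fixes c :: "nat \<Rightarrow> rat"
  assumes "finite K" "infinite S" "\<And>s. s \<in> S \<Longrightarrow> (\<Sum>k\<in>K. c k * s ^ k) = 0" "k \<in> K"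
  shows "c k = 0"
proof -
  define p where "p = (\<Sum>k\<in>K. monom (c k) k)"
  have "poly p s = 0" if "s \<in> S" for s
    using assms(3)[OF that] by (simp add: p_def poly_sum poly_monom)
  then have "S \<subseteq> {s. poly p s = 0}" by blast
  then have "p = 0"
    using poly_roots_finite[of p] assms(2) finite_subset by blast
  then have "coeff p k = 0" by simp
  moreover have "coeff p k = c k"
    using assms(1,4) by (simp add: p_def coeff_sum)
  ultimately show ?thesis by simp
qed

text \<open>Reading off the coefficient of one group element \<open>g\<close> turns the hypothesis
  into a statement about a rational polynomial in \<open>s\<close> and \<open>t\<close>. Vanishing
  on an infinite grid kills its coefficients, first in \<open>s\<close> for each fixed
  \<open>t\<close>, then in \<open>t\<close>.\<close>

lemma eval2_eq_zero_imp:
  assumes S: "infinite S" and T: "infinite T"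
    and zero: "\<And>s t. s \<in> S \<Longrightarrow> t \<in> T \<Longrightarrow> eval2 s t p = 0"
  shows "p = 0"
proof (rule poly_mapping_eqI, rule poly_mapping_eqI)
  fix m :: "nat \<times> nat" and g
  let ?c = "\<lambda>i j. Poly_Mapping.lookup (Poly_Mapping.lookup p (i, j)) g"
  \<comment> \<open>Inserting the components of \<open>m\<close> puts \<open>m\<close> into the box
    of \<open>I\<close> and \<open>J\<close> even when it is not a key of \<open>p\<close>.\<close>
  define I where "I = insert (fst m) (fst ` Poly_Mapping.keys p)"
  define J where "J = insert (snd m) (snd ` Poly_Mapping.keys p)"
  have fin: "finite I" "finite J" by (simp_all add: I_def J_def)
  have "(\<Sum>i\<in>I. (\<Sum>j\<in>J. ?c i j * t ^ j) * s ^ i) = 0" if st: "s \<in> S" "t \<in> T" for s t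
  proof -
    have scale: "Poly_Mapping.lookup (a * alg_scalar r) g = Poly_Mapping.lookup a g * r" for a r
    proof -
      have "Poly_Mapping.single k b * alg_scalar r = Poly_Mapping.single k (b * r)"
        for k :: "int perm additive" and b
        by (simp add: mult_single)
      then have "(\<Sum>k\<in>Poly_Mapping.keys a. Poly_Mapping.single k (Poly_Mapping.lookup a k)) * alg_scalar r =
          (\<Sum>k\<in>Poly_Mapping.keys a. Poly_Mapping.single k (Poly_Mapping.lookup a k * r))"
        by (simp only: sum_distrib_right)
      then have "a * alg_scalar r =
          (\<Sum>k\<in>Poly_Mapping.keys a. Poly_Mapping.single k (Poly_Mapping.lookup a k * r))"
        by (simp only: poly_mapping_sum_single)
      then show ?thesis
        by (auto simp: lookup_sum lookup_single when_def in_keys_iff)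
    qed
    have "Poly_Mapping.keys p \<subseteq> I \<times> J"
      unfolding I_def J_def by force
    then have "eval2 s t p =
        (\<Sum>k\<in>I \<times> J. Poly_Mapping.lookup p k * alg_scalar (s ^ fst k * t ^ snd k))"
      unfolding eval2_def using fin by (intro eval_with_superset) auto
    then have "Poly_Mapping.lookup (\<Sum>k\<in>I \<times> J.
        Poly_Mapping.lookup p k * alg_scalar (s ^ fst k * t ^ snd k)) g = 0"
      using zero[OF st] by simp
    then have "(\<Sum>k\<in>I \<times> J. ?c (fst k) (snd k) * (s ^ fst k * t ^ snd k)) = 0"
      by (simp only: lookup_sum scale prod.collapse)
    then have "(\<Sum>i\<in>I. \<Sum>j\<in>J. ?c i j * (s ^ i * t ^ j)) = 0"
      by (simp add: sum.cartesian_product split_def)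
    then show ?thesis
      by (simp add: sum_distrib_left mult_ac)
  qed
  then have "(\<Sum>j\<in>J. ?c i j * t ^ j) = 0" if "i \<in> I" "t \<in> T" for i t
    using finite_sum_powers_eq_zero[OF fin(1) S, of "\<lambda>i. \<Sum>j\<in>J. ?c i j * t ^ j"] that by blast
  then have "?c i j = 0" if "i \<in> I" "j \<in> J" for i j
    using finite_sum_powers_eq_zero[OF fin(2) T, of "?c i"] that by blast
  moreover have "fst m \<in> I" "snd m \<in> J" by (simp_all add: I_def J_def)
  ultimately have "?c (fst m) (snd m) = 0" by blast
  then show "Poly_Mapping.lookup (Poly_Mapping.lookup p m) g
      = Poly_Mapping.lookup (Poly_Mapping.lookup 0 m) g"
    by simp
qed

lemma eval2_eqI:
  assumes "infinite S" "infinite T" "\<And>s t. s \<in> S \<Longrightarrow> t \<in> T \<Longrightarrow> eval2 s t p = eval2 s t q"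
  shows "p = q"
proof -
  have "p - q = 0"
    using assms(3) by (intro eval2_eq_zero_imp[OF assms(1,2)]) (simp add: eval2_def eval_with_diff)
  then show ?thesis by simp
qed

lemma eval_with_poly_times_perm:
  "eval_with (\<lambda>k. alg_scalar (c ^ k)) (poly_times_perm p \<pi>)
    = Poly_Mapping.single (Additive \<pi>) (poly p c)"
proof -
  have "Additive \<pi> + 0 = Additive \<pi>" by simp
  then show ?thesis
    by (simp add: poly_times_perm_def eval_with_sum mult_single poly_altdef sum_single)
qed

text \<open>The generalized binomial coefficient prepares the comparison with the counting
  coefficient \<open>choose\<close> at natural arguments.\<close>

lemma poly_binom_poly: "poly (binom_poly [:a, 1:] n) c = (c + a) gchoose n"
  by (simp add: binom_poly_def gbinomial_prod_rev poly_prod atLeast0LessThan algebra_simps)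

subsection \<open>Sorting odd words\<close>

text \<open>Ties in \<open>f\<close> are broken by position, so this is a strict linear order even
  when values repeat; that is what makes sorting unambiguous.\<close>

definition word_less :: "(int \<Rightarrow> int) \<Rightarrow> int \<Rightarrow> int \<Rightarrow> bool" where
  "word_less f i j \<longleftrightarrow> f i < f j \<or> f i = f j \<and> i < j"

lemma word_less_irrefl: "\<not> word_less f i i"
  by (simp add: word_less_def)

lemma word_less_trans: "word_less f i j \<Longrightarrow> word_less f j k \<Longrightarrow> word_less f i k"
  by (auto simp: word_less_def)

lemma word_less_linear: "word_less f i j \<or> i = j \<or> word_less f j i"
  by (auto simp: word_less_def)

lemma word_less_uminus:
  assumes "\<And>i. f (- i) = - f i"
  shows "word_less f (- i) (- j) \<longleftrightarrow> word_less f j i"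
  by (auto simp: word_less_def assms)

text \<open>Only positions from 0 on are compared: as \<open>\<pi>\<close> is odd, the negative half
  is the mirror image whenever \<open>f\<close> is odd too.\<close>

definition sorts :: "nat \<Rightarrow> (int \<Rightarrow> int) \<Rightarrow> int perm \<Rightarrow> bool" where
  "sorts n f \<pi> \<longleftrightarrow> \<pi> \<in> hyperoctahedral n \<and>
    (\<forall>i\<in>{0..int n - 1}. word_less f (\<pi> \<langle>$\<rangle> i) (\<pi> \<langle>$\<rangle> (i + 1)))"

lemma hyperoctahedral_permutes:
  "\<pi> \<in> hyperoctahedral n \<Longrightarrow> apply \<pi> permutes {- int n..int n}"
  by (simp add: hyperoctahedral_def)

lemma hyperoctahedral_uminus:
  assumes "\<pi> \<in> hyperoctahedral n"
  shows "\<pi> \<langle>$\<rangle> (- i) = - (\<pi> \<langle>$\<rangle> i)"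
proof (cases "i \<in> {- int n..int n}")
  case True
  then show ?thesis using assms by (simp add: hyperoctahedral_def)
next
  case False
  then have "- i \<notin> {- int n..int n}" by auto
  with False show ?thesis
    using permutes_not_in[OF hyperoctahedral_permutes[OF assms]] by simp
qed

lemma hyperoctahedral_apply_0:
  "\<pi> \<in> hyperoctahedral n \<Longrightarrow> \<pi> \<langle>$\<rangle> 0 = 0"
  using hyperoctahedral_uminus[of \<pi> n 0] by simp

lemma hyperoctahedral_in_range_iff:
  "\<pi> \<in> hyperoctahedral n \<Longrightarrow> \<pi> \<langle>$\<rangle> i \<in> {- int n..int n} \<longleftrightarrow> i \<in> {- int n..int n}"
  by (rule permutes_in_image[OF hyperoctahedral_permutes])

lemma apply_inverse_cancel [simp]:
  "inverse \<pi> \<langle>$\<rangle> (\<pi> \<langle>$\<rangle> i) = i" "\<pi> \<langle>$\<rangle> (inverse \<pi> \<langle>$\<rangle> i) = i"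
  by (simp_all add: apply_sequence)

lemma hyperoctahedral_inverse:
  assumes "\<pi> \<in> hyperoctahedral n"
  shows "inverse \<pi> \<in> hyperoctahedral n"
proof -
  have "inverse \<pi> \<langle>$\<rangle> (- i) = - (inverse \<pi> \<langle>$\<rangle> i)" for i
    by (metis apply_inverse_cancel hyperoctahedral_uminus[OF assms])
  then show ?thesis
    using permutes_inv[OF hyperoctahedral_permutes[OF assms]]
    by (simp add: hyperoctahedral_def apply_inverse)
qed

text \<open>Adjacent comparisons at negative positions are reflections of those at nonnegative ones,
  because negation reverses \<open>word_less f\<close>; transitivity then chains them from
  \<open>i\<close> to \<open>j\<close>.\<close>

lemma sorts_word_less:
  assumes f: "\<And>i. f (- i) = - f i" and s: "sorts n f \<pi>"
    and ij: "- int n \<le> i" "i < j" "j \<le> int n"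
  shows "word_less f (\<pi> \<langle>$\<rangle> i) (\<pi> \<langle>$\<rangle> j)"
proof -
  have \<pi>: "\<pi> \<in> hyperoctahedral n" using s by (simp add: sorts_def)
  have adjacent: "word_less f (\<pi> \<langle>$\<rangle> i) (\<pi> \<langle>$\<rangle> (i + 1))" if "- int n \<le> i" "i < int n" for i
  proof (cases "i \<ge> 0")
    case True
    then show ?thesis using s that by (auto simp: sorts_def)
  next
    case False
    then have "word_less f (\<pi> \<langle>$\<rangle> (- i - 1)) (\<pi> \<langle>$\<rangle> (- i - 1 + 1))"
    proof -
      have "- i - 1 \<in> {0..int n - 1}" using False that by simp
      then show ?thesis using s unfolding sorts_def by blast
    qed
    moreover have "\<pi> \<langle>$\<rangle> (- i - 1) = - (\<pi> \<langle>$\<rangle> (i + 1))" "\<pi> \<langle>$\<rangle> (- i - 1 + 1) = - (\<pi> \<langle>$\<rangle> i)"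
      using hyperoctahedral_uminus[OF \<pi>, of "i + 1"] hyperoctahedral_uminus[OF \<pi>, of i]
      by simp_all
    ultimately show ?thesis
      by (simp add: word_less_uminus[of f, OF f])
  qed
  have "j \<le> int n \<longrightarrow> word_less f (\<pi> \<langle>$\<rangle> i) (\<pi> \<langle>$\<rangle> j)"
    using ij(2)
  proof (induction j rule: int_gr_induct)
    case base
    then show ?case using adjacent[of i] ij by simp
  next
    case (step j)
    then show ?case
      using adjacent[of j] ij(1) by (auto intro: word_less_trans)
  qed
  then show ?thesis using ij by simp
qed

lemma sorts_word_less_iff:
  assumes "\<And>i. f (- i) = - f i" "sorts n f \<pi>" "i \<in> {- int n..int n}" "j \<in> {- int n..int n}"
  shows "word_less f (\<pi> \<langle>$\<rangle> i) (\<pi> \<langle>$\<rangle> j) \<longleftrightarrow> i < j"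
  using sorts_word_less[of f, OF assms(1,2), of i j] sorts_word_less[of f, OF assms(1,2), of j i] assms(3,4)
  by (metis atLeastAtMost_iff linorder_cases word_less_irrefl word_less_trans)

section \<open>Ranks, and uniqueness and existence of the sorting permutation\<close>

definition rank_below :: "nat \<Rightarrow> (int \<Rightarrow> int) \<Rightarrow> int \<Rightarrow> int" where
  "rank_below n f m = int (card {l \<in> {- int n..int n}. word_less f l m}) - int n"

text \<open>\<open>\<pi>\<close> lists the interval increasingly, so the elements below
  \<open>\<pi> \<langle>$\<rangle> i\<close> are the images of the \<open>i + n\<close> positions
  before \<open>i\<close>. With the shift by \<open>n\<close>, the rank inverts the sorting
  permutation.\<close>

lemma rank_below_sorts:
  assumes f: "\<And>i. f (- i) = - f i" and s: "sorts n f \<pi>" and i: "i \<in> {- int n..int n}"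
  shows "rank_below n f (\<pi> \<langle>$\<rangle> i) = i"
proof -
  have \<pi>: "\<pi> \<in> hyperoctahedral n" using s by (simp add: sorts_def)
  have "{l \<in> {- int n..int n}. word_less f l (\<pi> \<langle>$\<rangle> i)} = apply \<pi> ` {- int n..<i}"
  proof (intro equalityI subsetI)
    fix l assume l: "l \<in> {l \<in> {- int n..int n}. word_less f l (\<pi> \<langle>$\<rangle> i)}"
    then obtain k where k: "l = \<pi> \<langle>$\<rangle> k" "k \<in> {- int n..int n}"
      using permutes_image[OF hyperoctahedral_permutes[OF \<pi>]] by (metis (no_types, lifting) imageE mem_Collect_eq)
    with l have "k < i" using sorts_word_less_iff[of f, OF f s _ i] by blast
    with k show "l \<in> apply \<pi> ` {- int n..<i}" by auto
  next
    fix l assume "l \<in> apply \<pi> ` {- int n..<i}"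
    then obtain k where k: "l = \<pi> \<langle>$\<rangle> k" "k \<in> {- int n..<i}" by blast
    then have kI: "k \<in> {- int n..int n}" using i by auto
    show "l \<in> {l \<in> {- int n..int n}. word_less f l (\<pi> \<langle>$\<rangle> i)}"
      using k sorts_word_less_iff[of f, OF f s kI i] hyperoctahedral_in_range_iff[OF \<pi>, of k] kI
      by simp
  qed
  moreover have "inj_on (apply \<pi>) {- int n..<i}"
    by (simp add: inj_on_def apply_inj)
  ultimately show ?thesis
    using i by (simp add: rank_below_def card_image)
qed

text \<open>The rank depends on \<open>f\<close> alone, so each value has the same position under
  both permutations.\<close>

lemma sorts_unique:
  assumes f: "\<And>i. f (- i) = - f i" and "sorts n f \<pi>" "sorts n f \<rho>"
  shows "\<pi> = \<rho>"
proof (rule perm_eqI)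
  fix i
  have \<pi>: "\<pi> \<in> hyperoctahedral n" and \<rho>: "\<rho> \<in> hyperoctahedral n"
    using assms by (simp_all add: sorts_def)
  show "\<pi> \<langle>$\<rangle> i = \<rho> \<langle>$\<rangle> i"
  proof (cases "i \<in> {- int n..int n}")
    case True
    then obtain j where j: "j \<in> {- int n..int n}" "\<pi> \<langle>$\<rangle> i = \<rho> \<langle>$\<rangle> j"
      using hyperoctahedral_in_range_iff[OF \<pi>] permutes_image[OF hyperoctahedral_permutes[OF \<rho>]]
      by (metis (no_types, lifting) imageE)
    then show ?thesis
      using rank_below_sorts[of f, OF f assms(2) True] rank_below_sorts[of f, OF f assms(3) j(1)] by simp
  next
    case False
    then show ?thesis
      using permutes_not_in[OF hyperoctahedral_permutes] \<pi> \<rho> by metis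
  qed
qed

lemma rank_below_strict:
  assumes "word_less f i j" "i \<in> {- int n..int n}"
  shows "rank_below n f i < rank_below n f j"
proof -
  have sub: "{l \<in> {- int n..int n}. word_less f l i} \<subset> {l \<in> {- int n..int n}. word_less f l j}"
    using assms word_less_irrefl word_less_trans by blast
  have "finite {l \<in> {- int n..int n}. word_less f l j}"
    by (rule finite_subset[of _ "{- int n..int n}"]) auto
  from psubset_card_mono[OF this sub] show ?thesis
    unfolding rank_below_def by linarith
qed

text \<open>The element \<open>i\<close> is not below itself, so at most \<open>2 n\<close> of the
  \<open>2 n + 1\<close> points are counted.\<close>

lemma rank_below_range:
  assumes "i \<in> {- int n..int n}"
  shows "rank_below n f i \<in> {- int n..int n}"
proof -
  have "{l \<in> {- int n..int n}. word_less f l i} \<subset> {- int n..int n}"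
    using assms word_less_irrefl by blast
  from psubset_card_mono[OF _ this] show ?thesis
    by (simp add: rank_below_def)
qed

text \<open>Negation carries the elements above \<open>i\<close> to those below \<open>- i\<close>.
  As \<open>i\<close>, the elements below it and those above it partition the \<open>2 n + 1\<close>
  points, the two counts add up to \<open>2 n\<close>, and the shift by \<open>n\<close> makes the
  ranks opposite.\<close>

lemma rank_below_uminus:
  assumes f: "\<And>i. f (- i) = - f i" and i: "i \<in> {- int n..int n}"
  shows "rank_below n f (- i) = - rank_below n f i"
proof -
  let ?I = "{- int n..int n}"
  let ?below = "{l \<in> ?I. word_less f l i}" and ?above = "{l \<in> ?I. word_less f i l}"
  have "{l \<in> ?I. word_less f l (- i)} = uminus ` ?above"
  proof (intro equalityI subsetI)
    fix l assume "l \<in> {l \<in> ?I. word_less f l (- i)}"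
    then have "- l \<in> ?above" using word_less_uminus[of f, OF f, of "- l" i] by auto
    then show "l \<in> uminus ` ?above" by (metis image_eqI minus_minus)
  qed (auto simp: word_less_uminus[of f, OF f])
  then have above: "card {l \<in> ?I. word_less f l (- i)} = card ?above"
    by (simp add: card_image)
  have "?I = insert i (?below \<union> ?above)"
    using i word_less_linear by blast
  then have "card ?I = card (insert i (?below \<union> ?above))"
    by (rule arg_cong)
  also have "\<dots> = Suc (card (?below \<union> ?above))"
    by (rule card_insert_disjoint)
      (auto simp: word_less_irrefl intro: finite_subset[of _ ?I])
  also have "card (?below \<union> ?above) = card ?below + card ?above"
  proof (rule card_Un_disjoint)
    show "finite ?below" "finite ?above"
      by (auto intro: finite_subset[of _ ?I])
    show "?below \<inter> ?above = {}"
      using word_less_irrefl word_less_trans by blast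
  qed
  finally show ?thesis
    unfolding rank_below_def above by simp
qed

text \<open>The rank map is injective on the interval and odd, hence a signed permutation, and its
  inverse sorts \<open>f\<close>.\<close>

lemma sorts_exists:
  assumes f: "\<And>i. f (- i) = - f i"
  shows "\<exists>\<pi>. sorts n f \<pi>"
proof -
  let ?I = "{- int n..int n}"
  \<comment> \<open>Fixing the points outside the interval makes \<open>r\<close> a permutation of
    all integers with finite support, as \<open>Perm\<close> requires.\<close>
  define r where "r i = (if i \<in> ?I then rank_below n f i else i)" for i
  have less: "r i < r j" if "word_less f i j" "i \<in> ?I" "j \<in> ?I" for i j
    using rank_below_strict[OF that(1,2)] that(2,3) by (simp add: r_def)
  have inj: "inj_on r ?I"
    by (rule inj_onI) (metis less less_irrefl word_less_linear)
  have "r ` ?I \<subseteq> ?I"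
    using rank_below_range by (fastforce simp: r_def)
  then have "bij_betw r ?I ?I"
    using inj by (simp add: bij_betw_def endo_inj_surj)
  then have perm: "r permutes ?I"
    by (rule bij_imp_permutes) (simp only: r_def if_False)
  have "finite {i. r i \<noteq> i}"
    by (rule finite_subset[of _ ?I]) (auto simp: r_def)
  then have app: "apply (Perm r) = r"
    using permutes_bij[OF perm] by (simp add: Perm_inverse)
  have odd: "r (- i) = - r i" if "i \<in> ?I" for i
    using rank_below_uminus[of f, OF f that] that by (auto simp: r_def)
  have H: "Perm r \<in> hyperoctahedral n"
    using perm odd by (simp add: hyperoctahedral_def app)
  define \<pi> where "\<pi> = inverse (Perm r)"
  have \<pi>: "\<pi> \<in> hyperoctahedral n"
    unfolding \<pi>_def by (rule hyperoctahedral_inverse[OF H])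
  have r\<pi>: "r (\<pi> \<langle>$\<rangle> i) = i" for i
  proof -
    have "Perm r \<langle>$\<rangle> (\<pi> \<langle>$\<rangle> i) = i" by (simp add: \<pi>_def)
    then show ?thesis by (simp only: app)
  qed
  have "word_less f (\<pi> \<langle>$\<rangle> i) (\<pi> \<langle>$\<rangle> (i + 1))" if "i \<in> {0..int n - 1}" for i
  proof -
    have "i \<in> ?I" "i + 1 \<in> ?I" using that by auto
    then have "\<pi> \<langle>$\<rangle> i \<in> ?I" "\<pi> \<langle>$\<rangle> (i + 1) \<in> ?I"
      by (simp_all only: hyperoctahedral_in_range_iff[OF \<pi>])
    \<comment> \<open>The opposite comparison would give \<open>i + 1 < i\<close> after applying
      \<open>r\<close>, and equality is excluded by injectivity.\<close>
    then show ?thesis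
      using word_less_linear[of f "\<pi> \<langle>$\<rangle> i" "\<pi> \<langle>$\<rangle> (i + 1)"] less[of "\<pi> \<langle>$\<rangle> (i + 1)" "\<pi> \<langle>$\<rangle> i"]
      by (auto simp: r\<pi> apply_inj)
  qed
  then show ?thesis
    using \<pi> by (auto simp: sorts_def)
qed

definition sort_word :: "nat \<Rightarrow> (int \<Rightarrow> int) \<Rightarrow> int perm" where
  "sort_word n f = (THE \<pi>. sorts n f \<pi>)"

lemma sort_word_eq_iff:
  assumes "\<And>i. f (- i) = - f i"
  shows "sort_word n f = \<pi> \<longleftrightarrow> sorts n f \<pi>"
  unfolding sort_word_def
  using sorts_exists[of f n, OF assms] sorts_unique[of f n, OF assms] theI[of "sorts n f"]
  by (metis the_equality)

subsection \<open>Products of words\<close>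

text \<open>This is the alphabet \<open>X\<^sub>x\<close> of the overview: the parity condition
  selects the integers of the parity of \<open>x - 1\<close>.\<close>

definition letters :: "nat \<Rightarrow> int set" where
  "letters x = {a. \<bar>a\<bar> < int x \<and> odd (a + int x)}"

text \<open>The value at 0 is always 0, even when 0 is not a letter.\<close>

definition words :: "nat \<Rightarrow> nat \<Rightarrow> (int \<Rightarrow> int) set" where
  "words n x = {f. (\<forall>i. f (- i) = - f i) \<and> (\<forall>i>int n. f i = 0) \<and> (\<forall>i\<in>{1..int n}. f i \<in> letters x)}"

lemma letters_uminus: "a \<in> letters x \<Longrightarrow> - a \<in> letters x"
  by (auto simp: letters_def)

lemma
  assumes "f \<in> words n x"
  shows words_uminus: "f (- i) = - f i"
    and words_letter: "i \<in> {- int n..int n} \<Longrightarrow> i \<noteq> 0 \<Longrightarrow> f i \<in> letters x"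
    and words_0: "f 0 = 0"
    and words_outside: "i \<notin> {- int n..int n} \<Longrightarrow> f i = 0"
proof -
  show odd: "f (- i) = - f i" for i using assms by (simp add: words_def)
  show "f 0 = 0" using odd[of 0] by simp
  show "f i \<in> letters x" if "i \<in> {- int n..int n}" "i \<noteq> 0"
  proof (cases "i > 0")
    case True
    then show ?thesis using assms that by (simp add: words_def)
  next
    case False
    then have "- i \<in> {1..int n}" using that by auto
    then have "f (- i) \<in> letters x" using assms unfolding words_def by blast
    then show ?thesis using letters_uminus[of "f (- i)"] odd[of i] by simp
  qed
  show "f i = 0" if "i \<notin> {- int n..int n}"
  proof (cases "i > 0")
    case True
    then show ?thesis using assms that by (simp add: words_def)
  next
    case False
    then have "- i > int n" using that by auto
    then have "f (- i) = 0" using assms unfolding words_def by blast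
    then show ?thesis using odd[of i] by simp
  qed
qed

lemma wordsI:
  assumes "\<And>i. f (- i) = - f i"
    and "\<And>i. i \<notin> {- int n..int n} \<Longrightarrow> f i = 0"
    and "\<And>i. i \<in> {- int n..int n} \<Longrightarrow> i \<noteq> 0 \<Longrightarrow> f i \<in> letters x"
  shows "f \<in> words n x"
  using assms by (auto simp: words_def)

lemma words_eqI:
  assumes f: "f \<in> words n x" and g: "g \<in> words n y"
    and eq: "\<And>i. i \<in> {- int n..int n} \<Longrightarrow> i \<noteq> 0 \<Longrightarrow> f i = g i"
  shows "f = g"
proof
  fix i
  show "f i = g i"
    using eq[of i] words_0[OF f] words_0[OF g] words_outside[OF f, of i] words_outside[OF g, of i]
    by (cases "i = 0"; cases "i \<in> {- int n..int n}") simp_all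
qed

lemma finite_words: "finite (words n x)"
proof (rule finite_imageD)
  let ?r = "\<lambda>f. restrict f {- int n..int n}"
  have "?r ` words n x \<subseteq> Pi\<^sub>E {- int n..int n} (\<lambda>_. {- int x..int x})"
  proof (rule image_subsetI, rule PiE_I)
    fix f i assume f: "f \<in> words n x"
    show "?r f i \<in> {- int x..int x}" if "i \<in> {- int n..int n}"
      using words_letter[OF f that] words_0[OF f] that by (cases "i = 0") (auto simp: letters_def)
    show "?r f i = undefined" if "i \<notin> {- int n..int n}"
      using that by (simp only: restrict_def if_False)
  qed
  then show "finite (?r ` words n x)"
    by (rule finite_subset) (simp add: finite_PiE)
  show "inj_on ?r (words n x)"
  proof (rule inj_onI, rule words_eqI)
    fix f g i assume "?r f = ?r g" "i \<in> {- int n..int n}"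
    then show "f i = g i" by (metis restrict_apply')
  qed
qed

text \<open>Letters of one alphabet share a parity, so \<open>b - b'\<close> is even. If it were
  nonzero, \<open>x\<close> times it would be at least \<open>2 x\<close> in absolute value, while
  \<open>a' - a\<close> stays below \<open>2 x\<close>.\<close>

lemma digits_unique:
  assumes "a \<in> letters x" "a' \<in> letters x" "b \<in> letters y" "b' \<in> letters y"
    and eq: "int x * b + a = int x * b' + a'"
  shows "a = a' \<and> b = b'"
proof -
  have x: "int x * (b - b') = a' - a" using eq by (simp add: algebra_simps)
  have "even (b - b')" using assms(3,4) by (auto simp: letters_def)
  then obtain c where c: "b - b' = 2 * c" by blast
  have "\<bar>a' - a\<bar> < 2 * int x" using assms(1,2) by (auto simp: letters_def)
  then have "int x * (2 * \<bar>c\<bar>) < int x * 2"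
    using arg_cong[OF x, of abs] by (simp add: c abs_mult)
  then have "\<bar>c\<bar> < 1" by (simp add: mult_less_cancel_left)
  then show ?thesis using c x by simp
qed

text \<open>For the parity, \<open>x b + a + x y\<close> equals \<open>x (b + y) + a\<close> with
  \<open>b + y\<close> odd. For the size, \<open>x (y - 1)\<close> bounds the first term and the
  second is smaller than \<open>x\<close>.\<close>

lemma digits_mem:
  assumes a: "a \<in> letters x" and b: "b \<in> letters y"
  shows "int x * b + a \<in> letters (x * y)"
proof -
  have "\<bar>int x * b\<bar> \<le> int x * (int y - 1)"
    using b unfolding abs_mult letters_def by (intro mult_mono) auto
  moreover have "\<bar>a\<bar> < int x" using a by (simp add: letters_def)
  ultimately have "\<bar>int x * b + a\<bar> < int x * int y" by (simp add: algebra_simps)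
  moreover have "odd (int x * b + a + int x * int y)"
    using a b by (auto simp: letters_def)
  ultimately show ?thesis by (simp add: letters_def)
qed

text \<open>Shifting and halving turns the letters for \<open>x * y\<close> into integers from 0 to
  \<open>x y - 1\<close>; division by \<open>x\<close> with remainder gives the digits, which are
  then doubled and recentred.\<close>

lemma digits_exist:
  assumes "c \<in> letters (x * y)"
  obtains a b where "a \<in> letters x" "b \<in> letters y" "c = int x * b + a"
proof -
  have c: "\<bar>c\<bar> < int x * int y" "odd (c + int x * int y)"
    using assms by (simp_all add: letters_def)
  then have "even (c + int x * int y - 1)" by simp
  then obtain e where e: "c + int x * int y - 1 = 2 * e" by blast
  have x: "int x > 0" using c(1) by (cases x) auto
  have y: "int y > 0" using c(1) by (cases y) auto
  define q r where "q = e div int x" and "r = e mod int x"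
  have e_eq: "e = int x * q + r" by (simp add: q_def r_def)
  have r: "0 \<le> r" "r < int x" using x by (simp_all add: r_def)
  have e_bounds: "0 \<le> e" "e < int x * int y" using c(1) e by auto
  then have "int x * q < int x * int y"
    using r e_eq by linarith
  then have q: "0 \<le> q" "q < int y"
    using x e_bounds(1) by (simp_all add: q_def pos_imp_zdiv_nonneg_iff)
  show ?thesis
  proof
    show "2 * r - (int x - 1) \<in> letters x" using r by (auto simp: letters_def)
    show "2 * q - (int y - 1) \<in> letters y" using q by (auto simp: letters_def)
    show "c = int x * (2 * q - (int y - 1)) + (2 * r - (int x - 1))"
      using e unfolding e_eq by (simp add: algebra_simps)
  qed
qed

text \<open>\<open>g\<close> supplies the leading digit and \<open>f\<close> the trailing one.
  Reading \<open>g\<close> through the inverse of the sorting permutation of \<open>f\<close>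
  attaches its letters to the entries in the order in which \<open>f\<close> sorts them.\<close>

definition lex_word :: "nat \<Rightarrow> nat \<Rightarrow> (int \<Rightarrow> int) \<Rightarrow> (int \<Rightarrow> int) \<Rightarrow> int \<Rightarrow> int" where
  "lex_word n x f g = (\<lambda>i. int x * g (inverse (sort_word n f) \<langle>$\<rangle> i) + f i)"

lemma sorts_sort_word: "f \<in> words n x \<Longrightarrow> sorts n f (sort_word n f)"
  using sort_word_eq_iff[of f] words_uminus by blast

text \<open>Along \<open>\<sigma> * \<tau>\<close> the leading digits are \<open>g\<close> read
  along \<open>\<tau>\<close>, hence weakly increasing; where they agree, \<open>\<tau>\<close>
  increases, and then \<open>\<sigma>\<close> puts the entries in the order of
  \<open>f\<close>.\<close>

lemma
  assumes f: "f \<in> words n x" and g: "g \<in> words n y"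
  shows lex_word_mem: "lex_word n x f g \<in> words n (x * y)"
    and sort_word_lex_word: "sort_word n (lex_word n x f g) = sort_word n f * sort_word n g"
proof -
  let ?I = "{- int n..int n}"
  define \<sigma> \<tau> h where "\<sigma> = sort_word n f" and "\<tau> = sort_word n g" and "h = lex_word n x f g"
  then have s: "sorts n f \<sigma>" and t: "sorts n g \<tau>"
    using sorts_sort_word f g by auto
  have h: "h = (\<lambda>i. int x * g (inverse \<sigma> \<langle>$\<rangle> i) + f i)"
    by (simp add: h_def \<sigma>_def lex_word_def)
  have \<sigma>: "\<sigma> \<in> hyperoctahedral n" and \<tau>: "\<tau> \<in> hyperoctahedral n"
    using s t by (simp_all add: sorts_def)
  note \<sigma>' = hyperoctahedral_inverse[OF \<sigma>]
  have nz: "inverse \<sigma> \<langle>$\<rangle> i \<noteq> 0" if "i \<noteq> 0" for i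
    using that hyperoctahedral_apply_0[OF \<sigma>'] apply_inj[of "inverse \<sigma>" i 0] by simp
  have h_words: "h \<in> words n (x * y)"
  proof (rule wordsI)
    show "h (- i) = - h i" for i
      by (simp add: h hyperoctahedral_uminus[OF \<sigma>'] words_uminus[OF f] words_uminus[OF g])
    show "h i = 0" if "i \<notin> ?I" for i
    proof -
      have "inverse \<sigma> \<langle>$\<rangle> i \<notin> ?I"
        using that hyperoctahedral_in_range_iff[OF \<sigma>'] by blast
      from words_outside[OF g this] words_outside[OF f that] show ?thesis
        by (simp add: h)
    qed
    show "h i \<in> letters (x * y)" if "i \<in> ?I" "i \<noteq> 0" for i
      unfolding h using that hyperoctahedral_in_range_iff[OF \<sigma>', of i] nz
      by (intro digits_mem words_letter[OF f] words_letter[OF g]) blast+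
  qed
  then show "lex_word n x f g \<in> words n (x * y)" by (simp add: h_def)
  have "sorts n h (\<sigma> * \<tau>)"
    unfolding sorts_def
  proof (intro conjI ballI)
    show "\<sigma> * \<tau> \<in> hyperoctahedral n" by (rule hyperoctahedral_times[OF \<sigma> \<tau>])
    fix i assume i: "i \<in> {0..int n - 1}"
    define u v where "u = \<tau> \<langle>$\<rangle> i" and "v = \<tau> \<langle>$\<rangle> (i + 1)"
    have uv: "word_less g u v" using t i by (auto simp: sorts_def u_def v_def)
    have "i \<in> ?I" "i + 1 \<in> ?I" using i by auto
    then have I: "u \<in> ?I" "v \<in> ?I" "\<sigma> \<langle>$\<rangle> u \<in> ?I" "\<sigma> \<langle>$\<rangle> v \<in> ?I"
      using hyperoctahedral_in_range_iff \<sigma> \<tau> unfolding u_def v_def by blast+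
    have "v \<noteq> 0"
      using i apply_inj[of \<tau> "i + 1" 0] hyperoctahedral_apply_0[OF \<tau>] by (simp add: v_def)
    then have "\<sigma> \<langle>$\<rangle> v \<noteq> 0"
      using apply_inj[of \<sigma> v 0] hyperoctahedral_apply_0[OF \<sigma>] by simp
    then have v: "g v \<in> letters y" "f (\<sigma> \<langle>$\<rangle> v) \<in> letters x"
      using words_letter[OF g I(2) \<open>v \<noteq> 0\<close>] words_letter[OF f I(4)] by blast+
    have h_apply: "h (\<sigma> \<langle>$\<rangle> w) = int x * g w + f (\<sigma> \<langle>$\<rangle> w)" for w
      by (simp add: h)
    have "word_less h (\<sigma> \<langle>$\<rangle> u) (\<sigma> \<langle>$\<rangle> v)"
    proof (cases "g u = g v")
      case True
      then have "u < v" using uv by (simp add: word_less_def)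
      then have "word_less f (\<sigma> \<langle>$\<rangle> u) (\<sigma> \<langle>$\<rangle> v)"
        using sorts_word_less[of f, OF words_uminus[OF f] s] I by simp
      then show ?thesis by (simp add: word_less_def h_apply True)
    next
      case False
      then have less: "g u < g v" using uv by (simp add: word_less_def)
      have "int x * g u + f (\<sigma> \<langle>$\<rangle> u) < int x * g v + f (\<sigma> \<langle>$\<rangle> v)"
      \<comment> \<open>Position 0 carries the value 0, which need not be a letter, so no parity gap
        is available there. Instead \<open>g v\<close> is at least 1 and \<open>f\<close> at
        \<open>\<sigma> \<langle>$\<rangle> v\<close> exceeds \<open>- x\<close>.\<close>
      proof (cases "u = 0")
        case True
        then have "g u = 0" "f (\<sigma> \<langle>$\<rangle> u) = 0"
          using words_0[OF g] words_0[OF f] hyperoctahedral_apply_0[OF \<sigma>] by simp_all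
        moreover have "int x * 1 \<le> int x * g v"
          using less \<open>g u = 0\<close> by (intro mult_left_mono) auto
        ultimately show ?thesis
          using v(2) by (auto simp: letters_def)
      next
        case False
        then have "\<sigma> \<langle>$\<rangle> u \<noteq> 0"
          using apply_inj[of \<sigma> u 0] hyperoctahedral_apply_0[OF \<sigma>] by simp
        then have u: "g u \<in> letters y" "f (\<sigma> \<langle>$\<rangle> u) \<in> letters x"
          using words_letter[OF g I(1) False] words_letter[OF f I(3)] by blast+
        \<comment> \<open>Equal parity widens the gap in \<open>g\<close> to at least 2, and
          \<open>2 x\<close> exceeds any difference of two letters of \<open>f\<close>.\<close>
        have "even (g v - g u)" using u v by (auto simp: letters_def)
        then have "g v - g u \<ge> 2" using less by presburger
        then have "int x * 2 \<le> int x * (g v - g u)" by (intro mult_left_mono) auto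
        then show ?thesis
          using u(2) v(2) by (auto simp: letters_def algebra_simps)
      qed
      then show ?thesis by (simp add: word_less_def h_apply)
    qed
    then show "word_less h ((\<sigma> * \<tau>) \<langle>$\<rangle> i) ((\<sigma> * \<tau>) \<langle>$\<rangle> (i + 1))"
      by (simp add: apply_times u_def v_def)
  qed
  then have "sort_word n h = \<sigma> * \<tau>"
    by (subst sort_word_eq_iff) (use words_uminus[OF h_words] in auto)
  then show "sort_word n (lex_word n x f g) = sort_word n f * sort_word n g"
    by (simp add: h_def \<sigma>_def \<tau>_def)
qed

text \<open>Uniqueness of digits recovers \<open>f\<close> first. Then the two sorting permutations
  coincide, and evaluating at \<open>\<sigma> \<langle>$\<rangle> i\<close> recovers
  \<open>g\<close>.\<close>

lemma lex_word_inj: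
  assumes f: "f \<in> words n x" "f' \<in> words n x" and g: "g \<in> words n y" "g' \<in> words n y"
    and eq: "lex_word n x f g = lex_word n x f' g'"
  shows "f = f' \<and> g = g'"
proof -
  let ?I = "{- int n..int n}"
  define \<sigma> \<sigma>' where "\<sigma> = sort_word n f" and "\<sigma>' = sort_word n f'"
  have \<sigma>: "\<sigma> \<in> hyperoctahedral n" and \<sigma>': "\<sigma>' \<in> hyperoctahedral n"
    using sorts_sort_word f unfolding \<sigma>_def \<sigma>'_def sorts_def by blast+
  have letter: "k (inverse \<rho> \<langle>$\<rangle> i) \<in> letters y"
    if "k \<in> words n y" "\<rho> \<in> hyperoctahedral n" "i \<in> ?I" "i \<noteq> 0" for k \<rho> i
  proof (rule words_letter[OF that(1)])
    note inv = hyperoctahedral_inverse[OF that(2)]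
    show "inverse \<rho> \<langle>$\<rangle> i \<in> ?I" using hyperoctahedral_in_range_iff[OF inv] that(3) by blast
    show "inverse \<rho> \<langle>$\<rangle> i \<noteq> 0"
      using that(4) hyperoctahedral_apply_0[OF inv] apply_inj[of "inverse \<rho>" i 0] by simp
  qed
  have digits: "f i = f' i \<and> g (inverse \<sigma> \<langle>$\<rangle> i) = g' (inverse \<sigma>' \<langle>$\<rangle> i)" if "i \<in> ?I" "i \<noteq> 0" for i
    using fun_cong[OF eq, of i] unfolding lex_word_def \<sigma>_def[symmetric] \<sigma>'_def[symmetric]
    by (rule digits_unique[OF words_letter[OF f(1) that] words_letter[OF f(2) that]
        letter[OF g(1) \<sigma> that] letter[OF g(2) \<sigma>' that]])
  then have ff': "f = f'" using words_eqI[OF f] by blast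
  moreover have "g = g'"
  proof (rule words_eqI[OF g])
    fix i assume i: "i \<in> ?I" "i \<noteq> 0"
    have "\<sigma> \<langle>$\<rangle> i \<in> ?I" using hyperoctahedral_in_range_iff[OF \<sigma>] i by blast
    moreover have "\<sigma> \<langle>$\<rangle> i \<noteq> 0"
      using i hyperoctahedral_apply_0[OF \<sigma>] apply_inj[of \<sigma> i 0] by simp
    ultimately show "g i = g' i"
      using digits[of "\<sigma> \<langle>$\<rangle> i"] ff' by (simp add: \<sigma>_def \<sigma>'_def)
  qed
  ultimately show ?thesis ..
qed

text \<open>Taking digits pointwise gives \<open>f\<close> and a word \<open>b\<close>, both odd
  because digits are unique. Sorting \<open>f\<close> then determines how \<open>b\<close> must be
  rearranged into \<open>g\<close>.\<close>

lemma lex_word_surj: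
  assumes h: "h \<in> words n (x * y)"
  obtains f g where "f \<in> words n x" "g \<in> words n y" "lex_word n x f g = h"
proof -
  let ?I = "{- int n..int n}"
  have "\<forall>c. \<exists>p. c \<in> letters (x * y) \<longrightarrow>
      fst p \<in> letters x \<and> snd p \<in> letters y \<and> c = int x * snd p + fst p"
    by (metis digits_exist fst_conv snd_conv)
  then obtain d where d: "\<And>c. c \<in> letters (x * y) \<Longrightarrow>
      fst (d c) \<in> letters x \<and> snd (d c) \<in> letters y \<and> c = int x * snd (d c) + fst (d c)"
    by metis
  define f where "f i = (if i \<in> ?I \<and> i \<noteq> 0 then fst (d (h i)) else 0)" for i
  define b where "b i = (if i \<in> ?I \<and> i \<noteq> 0 then snd (d (h i)) else 0)" for i
  have odd: "fst (d (- c)) = - fst (d c) \<and> snd (d (- c)) = - snd (d c)"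
    if c: "c \<in> letters (x * y)" for c
  proof (rule digits_unique)
    note c' = letters_uminus[OF c]
    show "fst (d (- c)) \<in> letters x" "snd (d (- c)) \<in> letters y" using d[OF c'] by auto
    show "- fst (d c) \<in> letters x" "- snd (d c) \<in> letters y" using d[OF c] letters_uminus by auto
    have "int x * snd (d (- c)) + fst (d (- c)) = - (int x * snd (d c) + fst (d c))"
      using d[OF c] d[OF c'] by auto
    then show "int x * snd (d (- c)) + fst (d (- c)) = int x * - snd (d c) + - fst (d c)" by simp
  qed
  have neg: "- i \<in> ?I \<longleftrightarrow> i \<in> ?I" for i by auto
  have hd: "h i \<in> letters (x * y)" "h (- i) = - h i" if "i \<in> ?I" "i \<noteq> 0" for i
    using words_letter[OF h that] words_uminus[OF h] by auto
  have f: "f \<in> words n x"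
  proof (rule wordsI)
    show "f (- i) = - f i" for i
      using odd[OF hd(1)[of i]] hd(2)[of i] neg[of i] by (cases "i \<in> ?I \<and> i \<noteq> 0") (simp_all only: f_def, auto)
    show "f i \<in> letters x" if "i \<in> ?I" "i \<noteq> 0" for i
      using that d[OF hd(1)[OF that]] by (simp add: f_def)
  qed (simp only: f_def, simp)
  have b: "b \<in> words n y"
  proof (rule wordsI)
    show "b (- i) = - b i" for i
      using odd[OF hd(1)[of i]] hd(2)[of i] neg[of i] by (cases "i \<in> ?I \<and> i \<noteq> 0") (simp_all only: b_def, auto)
    show "b i \<in> letters y" if "i \<in> ?I" "i \<noteq> 0" for i
      using that d[OF hd(1)[OF that]] by (simp add: b_def)
  qed (simp only: b_def, simp)
  define \<sigma> where "\<sigma> = sort_word n f"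
  have \<sigma>: "\<sigma> \<in> hyperoctahedral n"
    using sorts_sort_word[OF f] by (simp add: sorts_def \<sigma>_def)
  \<comment> \<open>Composing with \<open>\<sigma>\<close> cancels the inverse in
    \<open>lex_word\<close>.\<close>
  define g where "g i = b (\<sigma> \<langle>$\<rangle> i)" for i
  have "g \<in> words n y"
  proof (rule wordsI)
    show "g (- i) = - g i" for i
      by (simp add: g_def hyperoctahedral_uminus[OF \<sigma>] words_uminus[OF b])
    show "g i = 0" if "i \<notin> ?I" for i
      using that hyperoctahedral_in_range_iff[OF \<sigma>] words_outside[OF b] unfolding g_def by blast
    fix i assume i: "i \<in> ?I" "i \<noteq> 0"
    have "\<sigma> \<langle>$\<rangle> i \<noteq> 0"
      using i hyperoctahedral_apply_0[OF \<sigma>] apply_inj[of \<sigma> i 0] by simp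
    then show "g i \<in> letters y"
      using i(1) hyperoctahedral_in_range_iff[OF \<sigma>] words_letter[OF b] unfolding g_def by blast
  qed
  moreover have "lex_word n x f g = h"
  proof
    fix i
    have "lex_word n x f g i = int x * b i + f i"
      by (simp add: lex_word_def g_def \<sigma>_def)
    also have "\<dots> = h i"
    proof (cases "i \<in> ?I \<and> i \<noteq> 0")
      case True
      then show ?thesis using d[OF hd(1)[of i]] by (simp add: b_def f_def)
    next
      case False
      then have "b i = 0" "f i = 0" by (simp_all only: b_def f_def if_False)
      moreover have "h i = 0" using False words_0[OF h] words_outside[OF h, of i] by blast
      ultimately show ?thesis by simp
    qed
    finally show "lex_word n x f g i = h i" .
  qed
  ultimately show thesis using that f by blast
qed

section \<open>The group algebra elements \<Phi>(x) and their multiplicativity\<close>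

definition word_sum :: "nat \<Rightarrow> nat \<Rightarrow> perm_algebra" where
  "word_sum n x = (\<Sum>f\<in>words n x. Poly_Mapping.single (Additive (sort_word n f)) 1)"

text \<open>Forming \<open>lex_word\<close> is a bijection from pairs of words onto words over the
  larger alphabet and multiplies sorting permutations, so the double sum can be reindexed.\<close>

lemma word_sum_mult: "word_sum n x * word_sum n y = word_sum n (x * y)"
proof -
  have bij: "bij_betw (\<lambda>(f, g). lex_word n x f g) (words n x \<times> words n y) (words n (x * y))"
    unfolding bij_betw_def
  proof (intro conjI equalityI subsetI)
    show "inj_on (\<lambda>(f, g). lex_word n x f g) (words n x \<times> words n y)"
    proof (rule inj_onI, clarify)
      fix f g f' g'
      assume "f \<in> words n x" "g \<in> words n y" "f' \<in> words n x" "g' \<in> words n y"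
        "lex_word n x f g = lex_word n x f' g'"
      then show "f = f' \<and> g = g'" using lex_word_inj by blast
    qed
    show "h \<in> words n (x * y)"
      if "h \<in> (\<lambda>(f, g). lex_word n x f g) ` (words n x \<times> words n y)" for h
      using that lex_word_mem by auto
    show "h \<in> (\<lambda>(f, g). lex_word n x f g) ` (words n x \<times> words n y)"
      if "h \<in> words n (x * y)" for h
      using lex_word_surj[OF that] by (metis (no_types, lifting) SigmaI case_prod_conv image_eqI)
  qed
  have "word_sum n x * word_sum n y = (\<Sum>(f, g)\<in>words n x \<times> words n y.
      Poly_Mapping.single (Additive (sort_word n f * sort_word n g)) 1)"
    by (simp add: word_sum_def sum_product mult_single sum.cartesian_product)
  also have "\<dots> = (\<Sum>p\<in>words n x \<times> words n y.
      Poly_Mapping.single (Additive (sort_word n ((\<lambda>(f, g). lex_word n x f g) p))) 1)"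
    by (rule sum.cong) (auto simp: sort_word_lex_word)
  also have "\<dots> = word_sum n (x * y)"
    unfolding word_sum_def by (rule sum.reindex_bij_betw[OF bij])
  finally show ?thesis .
qed

subsection \<open>Words sorted by a given permutation\<close>

text \<open>
  Halving the values of a word along its sorting permutation gives a climb from 0, with strict
  steps at the positions in \<open>D\<close>.
\<close>

definition climbs :: "nat set \<Rightarrow> nat \<Rightarrow> nat \<Rightarrow> (nat \<Rightarrow> nat) set" where
  "climbs D n m = {a. a 0 = 0 \<and> (\<forall>i>n. a i = 0) \<and>
    (\<forall>i<n. a i + of_bool (i \<in> D) \<le> a (Suc i)) \<and> a n \<le> m}"

lemma climbs_0: "climbs D 0 m = {\<lambda>_. 0}"
proof -
  have "a = (\<lambda>_. 0)" if "a 0 = 0" "\<forall>i>0. a i = 0" for a :: "nat \<Rightarrow> nat"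
    using that by (metis neq0_conv)
  then have "climbs D 0 m \<subseteq> {\<lambda>_. 0}" unfolding climbs_def by blast
  moreover have "(\<lambda>_. 0) \<in> climbs D 0 m" by (simp add: climbs_def)
  ultimately show ?thesis by blast
qed

text \<open>Removing the last value \<open>t\<close> leaves a climb bounded by
  \<open>t - \<delta>\<close>. The lower limit \<open>\<delta>\<close> for \<open>t\<close> guards
  against truncated subtraction, which would otherwise admit \<open>t = 0\<close> after a strict
  step.\<close>

lemma bij_betw_climbs_Suc:
  fixes D n m
  defines "\<delta> \<equiv> of_bool (n \<in> D)"
  shows "bij_betw (\<lambda>a. (a (Suc n), a(Suc n := 0))) (climbs D (Suc n) m)
    (SIGMA t:{\<delta>..m}. climbs D n (t - \<delta>))"
proof (rule bij_betw_byWitness[where f' = "\<lambda>(t, a). a(Suc n := t)"])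
  show "\<forall>a\<in>climbs D (Suc n) m. (case (a (Suc n), a(Suc n := 0)) of (t, a) \<Rightarrow> a(Suc n := t)) = a"
    by simp
  show "\<forall>p\<in>SIGMA t:{\<delta>..m}. climbs D n (t - \<delta>).
      ((case p of (t, a) \<Rightarrow> a(Suc n := t)) (Suc n), (case p of (t, a) \<Rightarrow> a(Suc n := t))(Suc n := 0)) = p"
    by (auto simp: climbs_def fun_upd_idem)
  show "(\<lambda>a. (a (Suc n), a(Suc n := 0))) ` climbs D (Suc n) m \<subseteq> (SIGMA t:{\<delta>..m}. climbs D n (t - \<delta>))"
  proof (rule image_subsetI)
    fix a assume a: "a \<in> climbs D (Suc n) m"
    then have "a n + \<delta> \<le> a (Suc n)" by (auto simp: climbs_def \<delta>_def)
    with a show "(a (Suc n), a(Suc n := 0)) \<in> (SIGMA t:{\<delta>..m}. climbs D n (t - \<delta>))"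
      by (auto simp: climbs_def)
  qed
  show "(\<lambda>(t, a). a(Suc n := t)) ` (SIGMA t:{\<delta>..m}. climbs D n (t - \<delta>)) \<subseteq> climbs D (Suc n) m"
    by (auto simp: climbs_def less_Suc_eq \<delta>_def)
qed

lemma finite_climbs: "finite (climbs D n m)"
proof (induction n arbitrary: m)
  case 0
  then show ?case by (simp add: climbs_0)
next
  case (Suc n)
  then show ?case using bij_betw_finite[OF bij_betw_climbs_Suc] by blast
qed

text \<open>Summing over the last value gives a hockey-stick sum of binomial coefficients, in which
  each strict step lowers the upper index by one.\<close>

lemma card_climbs: "card (climbs D n m) = (m + n - card (D \<inter> {..<n})) choose n"
proof (induction n arbitrary: m)
  case 0
  then show ?case by (simp add: climbs_0)
next
  case (Suc n)
  define \<delta> :: nat where "\<delta> = of_bool (n \<in> D)"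
  define d where "d = card (D \<inter> {..<n})"
  have d: "d \<le> n" unfolding d_def using card_mono[of "{..<n}" "D \<inter> {..<n}"] by simp
  have d_Suc: "card (D \<inter> {..<Suc n}) = d + \<delta>"
    by (auto simp: d_def \<delta>_def lessThan_Suc)
  have "card (climbs D (Suc n) m) = card (SIGMA t:{\<delta>..m}. climbs D n (t - \<delta>))"
    unfolding \<delta>_def by (rule bij_betw_same_card[OF bij_betw_climbs_Suc])
  also have "\<dots> = (\<Sum>t=\<delta>..m. (t - \<delta> + n - d) choose n)"
    by (simp add: card_SigmaI finite_climbs Suc d_def)
  also have "\<dots> = (m + Suc n - (d + \<delta>)) choose Suc n"
  proof (cases "\<delta> \<le> m")
    \<comment> \<open>Here a strict step meets the bound 0: the sum is empty, and on the right the
      upper index \<open>n - d\<close> is below the lower one.\<close>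
    case False
    then have "m = 0" "\<delta> = 1" by (cases "n \<in> D"; simp add: \<delta>_def)+
    then show ?thesis using d by (simp add: binomial_eq_0)
  next
    case True
    then obtain k where k: "m = k + \<delta>" using le_Suc_ex by (metis add.commute)
    have "(\<Sum>t=\<delta>..k + \<delta>. (t - \<delta> + n - d) choose n) = (\<Sum>t\<le>k. (t + n - d) choose n)"
      using sum.shift_bounds_cl_nat_ivl[of "\<lambda>t. (t - \<delta> + n - d) choose n" 0 \<delta> k]
      by (simp add: atMost_atLeast0)
    \<comment> \<open>Hockey-stick summation by Pascal's rule; \<open>d \<le> n\<close> keeps the
      natural subtraction exact.\<close>
    also have "\<dots> = (k + Suc n - d) choose Suc n"
    proof (induction k)
      case 0
      have "Suc n - d = Suc (n - d)" using d by simp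
      then show ?case by (simp add: binomial_eq_0)
    next
      case (Suc k)
      have "Suc k + Suc n - d = Suc (Suc k + n - d)" using d by simp
      then show ?case using Suc by simp
    qed
    finally show ?thesis by (simp add: k)
  qed
  finally show ?case by (simp add: d_Suc)
qed

text \<open>
  For even \<open>x\<close> the letter 0 is missing, so a sorted word must leave the value 0 immediately,
  whether or not there is a descent at 0.
\<close>

definition strict_positions :: "nat \<Rightarrow> nat \<Rightarrow> int perm \<Rightarrow> nat set" where
  "strict_positions n x \<pi> = {i. i < n \<and>
    (\<pi> \<langle>$\<rangle> (int i) > \<pi> \<langle>$\<rangle> (int i + 1) \<or> even x \<and> i = 0)}"

text \<open>Along \<open>\<pi>\<close> the values at positions 1 to \<open>n\<close> are nonnegative
  letters, hence of the form \<open>2 a - 1\<close> for even \<open>x\<close> and \<open>2 a\<close>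
  for odd \<open>x\<close>; in both cases \<open>(v + 1) div 2\<close> returns \<open>a\<close>.
  Between these positions, equal neighbours are allowed exactly where \<open>\<pi>\<close> ascends,
  so descents become strict steps.\<close>

lemma bij_betw_sorted_words:
  assumes \<pi>: "\<pi> \<in> hyperoctahedral n" and x: "x > 0"
  shows "bij_betw (\<lambda>f i. if i \<le> n then nat ((f (\<pi> \<langle>$\<rangle> (int i)) + 1) div 2) else 0)
    {f \<in> words n x. sort_word n f = \<pi>} (climbs (strict_positions n x \<pi>) n (x div 2))"
    (is "bij_betw ?F ?W ?C")
proof -
  let ?I = "{- int n..int n}" and ?D = "strict_positions n x \<pi>"
  define e :: int where "e = of_bool (even x)"
  \<comment> \<open>The inverse map. The factor \<open>sgn i\<close> extends the values oddly to
    negative positions and also gives 0 at position 0, where \<open>2 a - e\<close> would be -1 for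
    even \<open>x\<close>.\<close>
  define G where "G a j = (let i = inverse \<pi> \<langle>$\<rangle> j in
      if \<bar>i\<bar> \<le> int n then sgn i * (2 * int (a (nat \<bar>i\<bar>)) - e) else 0)" for a j
  have \<pi>': "inverse \<pi> \<in> hyperoctahedral n" by (rule hyperoctahedral_inverse[OF \<pi>])
  have G_apply: "G a (\<pi> \<langle>$\<rangle> (int i)) = (if i = 0 \<or> i > n then 0 else 2 * int (a i) - e)" for a i
    by (auto simp: G_def Let_def)
  have sorted: "0 \<le> f (\<pi> \<langle>$\<rangle> (int i)) \<and> (i \<noteq> 0 \<longrightarrow> f (\<pi> \<langle>$\<rangle> (int i)) \<in> letters x)"
      "i < n \<Longrightarrow> word_less f (\<pi> \<langle>$\<rangle> (int i)) (\<pi> \<langle>$\<rangle> (int i + 1))"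
    if f: "f \<in> ?W" and i: "i \<le> n" for f i
  proof -
    have fw: "f \<in> words n x" and fs: "sorts n f \<pi>"
      using f sorts_sort_word by auto
    show "word_less f (\<pi> \<langle>$\<rangle> (int i)) (\<pi> \<langle>$\<rangle> (int i + 1))" if "i < n"
      using fs that by (auto simp: sorts_def)
    have I: "int i \<in> ?I" "0 \<in> ?I" using i by auto
    have "f (\<pi> \<langle>$\<rangle> (int i)) \<in> letters x" if "i \<noteq> 0"
    proof (rule words_letter[OF fw])
      show "\<pi> \<langle>$\<rangle> (int i) \<in> ?I" using I(1) hyperoctahedral_in_range_iff[OF \<pi>] by blast
      show "\<pi> \<langle>$\<rangle> (int i) \<noteq> 0"
        using that hyperoctahedral_apply_0[OF \<pi>] apply_inj[of \<pi> "int i" 0] by simp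
    qed
    moreover have "0 \<le> f (\<pi> \<langle>$\<rangle> (int i))"
    proof (cases "i = 0")
      case False
      then show ?thesis
        using sorts_word_less[of f, OF words_uminus[OF fw] fs, of 0 "int i"] i
          words_0[OF fw] hyperoctahedral_apply_0[OF \<pi>]
        by (auto simp: word_less_def)
    qed (simp add: hyperoctahedral_apply_0[OF \<pi>] words_0[OF fw])
    ultimately show "0 \<le> f (\<pi> \<langle>$\<rangle> (int i)) \<and> (i \<noteq> 0 \<longrightarrow> f (\<pi> \<langle>$\<rangle> (int i)) \<in> letters x)" by blast
  qed
  have halve: "f (\<pi> \<langle>$\<rangle> (int i)) = 2 * int (?F f i) - e" if "f \<in> ?W" "i \<le> n" "i \<noteq> 0" for f i
  proof -
    have nonneg: "0 \<le> f (\<pi> \<langle>$\<rangle> (int i))" and "f (\<pi> \<langle>$\<rangle> (int i)) \<in> letters x"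
      using sorted[of f i] that by auto
    then have "odd (f (\<pi> \<langle>$\<rangle> (int i)) + int x)" by (simp add: letters_def)
    then have "f (\<pi> \<langle>$\<rangle> (int i)) = 2 * ((f (\<pi> \<langle>$\<rangle> (int i)) + 1) div 2) - e"
      unfolding e_def by (cases "even x") (auto elim!: evenE oddE)
    then show ?thesis using nonneg that by simp
  qed
  have F_0: "?F f 0 = 0" if "f \<in> ?W" for f
    using that words_0[of f n x] by (simp add: hyperoctahedral_apply_0[OF \<pi>])
  show ?thesis
  proof (rule bij_betw_byWitness[where f' = G])
    show "\<forall>f\<in>?W. G (?F f) = f"
    proof (intro ballI ext)
      fix f j assume f: "f \<in> ?W"
      then have fw: "f \<in> words n x" by simp
      obtain i where i: "j = \<pi> \<langle>$\<rangle> i" by (metis apply_inverse_cancel(2))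
      define a where "a = ?F f"
      have f_eq: "f (\<pi> \<langle>$\<rangle> (int k)) = 2 * int (a k) - e" if "k \<le> n" "k \<noteq> 0" for k
        using halve[OF f that] by (simp only: a_def)
      consider "i \<notin> ?I" | "i = 0" | "0 < i" "i \<le> int n" | "i < 0" "- i \<le> int n" by fastforce
      then have "G a j = f j"
      proof cases
        case 1
        then have "j \<notin> ?I" using i hyperoctahedral_in_range_iff[OF \<pi>] by blast
        then have "f j = 0" by (rule words_outside[OF fw])
        moreover have "\<not> \<bar>i\<bar> \<le> int n" using 1 by auto
        ultimately show ?thesis by (simp add: G_def i)
      next
        case 2
        then show ?thesis by (simp add: G_def i hyperoctahedral_apply_0[OF \<pi>] hyperoctahedral_apply_0[OF \<pi>'] words_0[OF fw])
      next
        case 3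
        then have "f (\<pi> \<langle>$\<rangle> i) = 2 * int (a (nat i)) - e"
          using f_eq[of "nat i"] by (simp add: nat_le_iff)
        then show ?thesis using 3 by (simp add: G_def i)
      next
        case 4
        then have "f (\<pi> \<langle>$\<rangle> (- i)) = 2 * int (a (nat (- i))) - e"
          using f_eq[of "nat (- i)"] by (simp add: nat_le_iff)
        moreover have "f (\<pi> \<langle>$\<rangle> (- i)) = - f j"
          by (simp add: hyperoctahedral_uminus[OF \<pi>] words_uminus[OF fw] i)
        ultimately show ?thesis using 4 by (simp add: G_def i)
      qed
      then show "G (?F f) j = f j" by (simp only: a_def)
    qed
    show "\<forall>a\<in>?C. ?F (G a) = a"
    proof (intro ballI ext)
      fix a i assume "a \<in> ?C"
      then show "?F (G a) i = a i"
        by (auto simp: G_apply climbs_def e_def)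
    qed
    show "?F ` ?W \<subseteq> ?C"
    proof (rule image_subsetI)
      fix f assume f: "f \<in> ?W"
      define a where "a = ?F f"
      have f_eq: "f (\<pi> \<langle>$\<rangle> (int i)) = 2 * int (a i) - e" if "i \<le> n" "i \<noteq> 0" for i
        using halve[OF f that] by (simp only: a_def)
      have f_0: "f (\<pi> \<langle>$\<rangle> 0) = 0" "a 0 = 0"
        using f words_0[of f n x] F_0[OF f] by (simp_all add: hyperoctahedral_apply_0[OF \<pi>] a_def)
      have "a i + of_bool (i \<in> ?D) \<le> a (Suc i)" if i: "i < n" for i
      proof -
        have next_eq: "f (\<pi> \<langle>$\<rangle> (int i + 1)) = 2 * int (a (Suc i)) - e"
          using f_eq[of "Suc i"] i by (simp add: add.commute)
        moreover have "0 \<le> f (\<pi> \<langle>$\<rangle> (int i + 1))"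
          using sorted(1)[OF f, of "Suc i"] i by (simp add: add.commute)
        moreover note sorted(2)[OF f less_imp_le[OF i] i]
        \<comment> \<open>For even \<open>x\<close> and \<open>i = 0\<close> the next value is odd
          and nonnegative, so \<open>a\<close> rises by at least 1 even without a descent.\<close>
        ultimately show ?thesis
          using f_eq[of i] f_0 i
          by (cases "i = 0"; cases "even x") (auto simp: word_less_def strict_positions_def e_def split: if_splits)
      qed
      moreover have "a n \<le> x div 2"
      proof (cases "n = 0")
        case False
        then have "f (\<pi> \<langle>$\<rangle> (int n)) < int x"
          using sorted(1)[OF f, of n] by (auto simp: letters_def)
        then show ?thesis
          using f_eq[of n] False by (cases "even x") (auto simp: e_def elim!: evenE oddE)
      qed (use f_0 in simp)
      ultimately show "?F f \<in> ?C"
        using f_0(2) unfolding a_def[symmetric] climbs_def by (simp add: a_def)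
    qed
    show "G ` ?C \<subseteq> ?W"
    proof (rule image_subsetI)
      fix a assume a: "a \<in> ?C"
      have step: "a i + of_bool (i \<in> ?D) \<le> a (Suc i)" if "i < n" for i
        using a that by (simp add: climbs_def)
      have mono: "a i \<le> a k" if "i \<le> k" "k \<le> n" for i k
        using that
      proof (induction k rule: dec_induct)
        case (step k)
        then show ?case using \<open>\<And>i. i < n \<Longrightarrow> a i + of_bool (i \<in> ?D) \<le> a (Suc i)\<close>[of k] by simp
      qed simp
      have pos: "a k > 0" if "even x" "0 < k" "k \<le> n" for k
        using step[of 0] mono[of "Suc 0" k] that by (simp add: strict_positions_def)
      have letter: "2 * int (a k) - e \<in> letters x" if k: "0 < k" "k \<le> n" for k
      proof -
        have "a k \<le> x div 2" using mono[of k n] k a by (simp add: climbs_def)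
        then show ?thesis
          using pos[OF _ k] by (cases "even x") (auto simp: letters_def e_def elim!: evenE oddE)
      qed
      have G_words: "G a \<in> words n x"
      proof (rule wordsI)
        show "G a (- j) = - G a j" for j
          by (simp add: G_def Let_def hyperoctahedral_uminus[OF \<pi>'])
        show "G a j = 0" if "j \<notin> ?I" for j
        proof -
          have "inverse \<pi> \<langle>$\<rangle> j \<notin> ?I" using that hyperoctahedral_in_range_iff[OF \<pi>'] by blast
          then show ?thesis by (auto simp: G_def Let_def)
        qed
        fix j assume j: "j \<in> ?I" "j \<noteq> 0"
        define i where "i = inverse \<pi> \<langle>$\<rangle> j"
        have "i \<in> ?I" using j(1) hyperoctahedral_in_range_iff[OF \<pi>'] unfolding i_def by blast
        moreover have "i \<noteq> 0"
          using j(2) apply_inj[of "inverse \<pi>" j 0] hyperoctahedral_apply_0[OF \<pi>'] by (simp add: i_def)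
        ultimately have i: "0 < nat \<bar>i\<bar>" "nat \<bar>i\<bar> \<le> n" by auto
        have "G a j = sgn i * (2 * int (a (nat \<bar>i\<bar>)) - e)"
          using i(2) by (simp add: G_def Let_def i_def nat_le_iff)
        then show "G a j \<in> letters x"
          using letter[OF i] letters_uminus[OF letter[OF i]] i by (cases "i > 0") simp_all
      qed
      have "sorts n (G a) \<pi>"
        unfolding sorts_def
      proof (intro conjI ballI \<pi>)
        fix l assume l: "l \<in> {0..int n - 1}"
        define i where "i = nat l"
        have i: "i < n" "l = int i" using l by (auto simp: i_def)
        have next_eq: "G a (\<pi> \<langle>$\<rangle> (int i + 1)) = 2 * int (a (Suc i)) - e"
          using G_apply[of a "Suc i"] i by (simp add: add.commute)
        have a_0: "a 0 = 0" using a by (simp add: climbs_def)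
        have "\<pi> \<langle>$\<rangle> (int i + 1) \<noteq> \<pi> \<langle>$\<rangle> (int i)" by (simp add: apply_inj)
        \<comment> \<open>At a descent the strict step makes the values increase; at an ascent equal
          values are still ordered by the tie-break. At \<open>i = 0\<close> with even
          \<open>x\<close> the value \<open>2 a - 1\<close> is already positive.\<close>
        then show "word_less (G a) (\<pi> \<langle>$\<rangle> l) (\<pi> \<langle>$\<rangle> (l + 1))"
          using step[of i] G_apply[of a i] next_eq i a_0
          by (cases "\<pi> \<langle>$\<rangle> (int i + 1)" "\<pi> \<langle>$\<rangle> (int i)" rule: linorder_cases;
              cases "i = 0"; cases "even x")
            (auto simp: word_less_def strict_positions_def e_def split: if_splits)
      qed
      then have "sort_word n (G a) = \<pi>"
        by (subst sort_word_eq_iff) (use words_uminus[OF G_words] in auto)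
      with G_words show "G a \<in> ?W" by simp
    qed
  qed
qed

text \<open>Words are grouped by their sorting permutation, and each group is counted by
  climbs.\<close>

lemma word_sum_eq:
  assumes x: "x > 0"
  shows "word_sum n x = (\<Sum>\<pi>\<in>hyperoctahedral n. Poly_Mapping.single (Additive \<pi>)
    (of_nat ((x div 2 + n - card (strict_positions n x \<pi>)) choose n)))"
proof -
  have "sort_word n ` words n x \<subseteq> hyperoctahedral n"
    using sorts_sort_word by (auto simp: sorts_def)
  then have "word_sum n x = (\<Sum>\<pi>\<in>hyperoctahedral n.
      \<Sum>f | f \<in> words n x \<and> sort_word n f = \<pi>. Poly_Mapping.single (Additive (sort_word n f)) 1)"
    unfolding word_sum_def
    by (intro sum.group[symmetric] finite_words finite_hyperoctahedral)
  also have "\<dots> = (\<Sum>\<pi>\<in>hyperoctahedral n. Poly_Mapping.single (Additive \<pi>)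
    (of_nat ((x div 2 + n - card (strict_positions n x \<pi>)) choose n)))"
  proof (rule sum.cong[OF refl])
    fix \<pi> assume \<pi>: "\<pi> \<in> hyperoctahedral n"
    have "strict_positions n x \<pi> \<inter> {..<n} = strict_positions n x \<pi>"
      by (auto simp: strict_positions_def)
    then have "card {f \<in> words n x. sort_word n f = \<pi>} =
        (x div 2 + n - card (strict_positions n x \<pi>)) choose n"
      using bij_betw_same_card[OF bij_betw_sorted_words[OF \<pi> x]] by (simp add: card_climbs)
    moreover have "(\<Sum>f | f \<in> words n x \<and> sort_word n f = \<pi>.
        Poly_Mapping.single (Additive (sort_word n f)) 1) =
        (\<Sum>f | f \<in> words n x \<and> sort_word n f = \<pi>. Poly_Mapping.single (Additive \<pi>) (1 :: rat))"
      by (rule sum.cong) auto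
    ultimately show "(\<Sum>f | f \<in> words n x \<and> sort_word n f = \<pi>.
        Poly_Mapping.single (Additive (sort_word n f)) 1) =
        Poly_Mapping.single (Additive \<pi>)
          (of_nat ((x div 2 + n - card (strict_positions n x \<pi>)) choose n) :: rat)"
      by (simp only: sum_single sum_constant mult_1_right)
  qed
  finally show ?thesis .
qed

section \<open>Descent numbers and the values of \<open>phi_A\<close> and
  \<open>phi_B\<close>\<close>

lemma card_strict_positions_odd:
  "odd x \<Longrightarrow> card (strict_positions n x \<pi>) = des_B n \<pi>"
  unfolding des_B_def
  by (rule bij_betw_same_card[of int], rule bij_betw_byWitness[where f' = nat])
    (auto simp: strict_positions_def)

text \<open>Position 0 is always strict for even \<open>x\<close>, and the other strict positions
  are the descents counted by \<open>des_A\<close>. The extra one explains the \<open>n - 1\<close>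
  in \<open>phi_A\<close> against the \<open>n\<close> in \<open>phi_B\<close>.\<close>

lemma card_strict_positions_even:
  assumes "even x" "n \<ge> 1"
  shows "card (strict_positions n x \<pi>) = Suc (des_A n \<pi>)"
proof -
  let ?A = "{i \<in> {1..int n - 1}. \<pi> \<langle>$\<rangle> i > \<pi> \<langle>$\<rangle> (i + 1)}"
  have "card (strict_positions n x \<pi>) = card (insert 0 ?A)"
    by (rule bij_betw_same_card[of int], rule bij_betw_byWitness[where f' = nat])
      (use assms in \<open>auto simp: strict_positions_def\<close>)
  moreover have "finite ?A"
    by (rule finite_subset[of _ "{1..int n - 1}"]) auto
  then have "card (insert 0 ?A) = Suc (des_A n \<pi>)"
    unfolding des_A_def by (intro card_insert_disjoint) auto
  ultimately show ?thesis by simp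
qed

text \<open>This makes the natural subtraction in the count exact, so that it agrees with the
  rational one in \<open>phi_A\<close> and \<open>phi_B\<close>.\<close>

lemma strict_positions_le: "card (strict_positions n x \<pi>) \<le> n"
  using card_mono[of "{..<n}" "strict_positions n x \<pi>"] by (auto simp: strict_positions_def)

lemma eval_phi_A:
  assumes "n \<ge> 1" "j > 0"
  shows "eval_with (\<lambda>k. alg_scalar (of_nat j ^ k)) (phi_A n) = word_sum n (2 * j)"
proof -
  have "of_nat j + (of_nat n - 1 - of_nat (des_A n \<pi>)) =
      (of_nat (j + n - card (strict_positions n (2 * j) \<pi>)) :: rat)" for \<pi>
    using card_strict_positions_even[of "2 * j" n \<pi>] strict_positions_le[of n "2 * j" \<pi>] assms
    by (simp add: of_nat_diff)
  then show ?thesis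
    using assms by (simp add: phi_A_def eval_with_sum eval_with_poly_times_perm poly_binom_poly
        word_sum_eq binomial_gbinomial)
qed

lemma eval_phi_B:
  "eval_with (\<lambda>k. alg_scalar (of_nat j ^ k)) (phi_B n) = word_sum n (2 * j + 1)"
proof -
  have "of_nat j + (of_nat n - of_nat (des_B n \<pi>)) =
      (of_nat (j + n - card (strict_positions n (2 * j + 1) \<pi>)) :: rat)" for \<pi>
    using card_strict_positions_odd[of "2 * j + 1" n \<pi>] strict_positions_le[of n "2 * j + 1" \<pi>]
    by (simp add: of_nat_diff)
  then show ?thesis
    by (simp add: phi_B_def eval_with_sum eval_with_poly_times_perm poly_binom_poly
        word_sum_eq binomial_gbinomial)
qed

text \<open>\<open>Suc j\<close> keeps the even evaluation points positive, as the evaluation of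
  \<open>phi_A\<close> demands.\<close>

lemma infinite_range_of_nat: "infinite (range (\<lambda>j. 2 * of_nat (Suc j) + c :: rat))"
  by (rule range_inj_infinite) (auto intro: injI)

theorem theorem2p7p4:
  fixes n :: nat
  assumes "n \<ge> 1"
  shows "subst2 (phi_A n) (half * indet_x) * subst2 (phi_B n) (half * (indet_y - 1))
           = subst2 (phi_A n) (half * (indet_x * indet_y))
       \<and> subst2 (phi_B n) (half * (indet_x - 1)) * subst2 (phi_A n) (half * indet_y)
           = subst2 (phi_A n) (half * (indet_x * indet_y))"
proof -
  \<comment> \<open>Even values make halving exact for \<open>phi_A\<close>, odd values do so for
    \<open>phi_B\<close> after subtracting 1, and an even times an odd value is even. Hence every
    argument is a natural number.\<close>
  let ?even = "range (\<lambda>j. 2 * of_nat (Suc j) + 0 :: rat)"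
  let ?odd = "range (\<lambda>j. 2 * of_nat (Suc j) + 1 :: rat)"
  have half: "eval2 s t (half * p) = alg_scalar (c / 2)" if "eval2 s t p = alg_scalar c" for s t p c
    by (simp add: eval2_mult half_def that alg_scalar_mult)
  have minus_1: "eval2 s t (p - 1) = alg_scalar (c - 1)" if "eval2 s t p = alg_scalar c" for s t p c
  proof -
    have "eval2 s t (p - 1) = eval2 s t p - eval2 s t 1"
      unfolding eval2_def by (rule eval_with_diff)
    then show ?thesis by (simp add: that single_diff)
  qed
  have xy: "eval2 s t (indet_x * indet_y) = alg_scalar (s * t)" for s t
    by (simp add: eval2_mult alg_scalar_mult)
  have A: "eval2 s t (subst2 (phi_A n) (half * p)) = word_sum n (2 * j)"
    if "eval2 s t p = alg_scalar (2 * of_nat j)" "j > 0" for s t p j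
    using eval2_subst2[OF half[OF that(1)], of "phi_A n"] eval_phi_A[OF assms that(2)] by simp
  have B: "eval2 s t (subst2 (phi_B n) (half * (p - 1))) = word_sum n (2 * j + 1)"
    if "eval2 s t p = alg_scalar (2 * of_nat j + 1)" for s t p j
    using eval2_subst2[OF half[OF minus_1[OF that(1)]], of "phi_B n"] eval_phi_B[of j n] by simp
  have "subst2 (phi_A n) (half * indet_x) * subst2 (phi_B n) (half * (indet_y - 1))
      = subst2 (phi_A n) (half * (indet_x * indet_y))"
  proof (rule eval2_eqI[OF infinite_range_of_nat[of 0] infinite_range_of_nat[of 1]])
    fix s t assume "s \<in> ?even" "t \<in> ?odd"
    then obtain j k where s: "s = 2 * of_nat (Suc j)" and t: "t = 2 * of_nat (Suc k) + 1" by auto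
    have st: "s * t = 2 * of_nat (Suc j * (2 * Suc k + 1))" by (simp add: s t algebra_simps)
    have "eval2 s t (subst2 (phi_A n) (half * indet_x)) = word_sum n (2 * Suc j)"
      by (rule A) (simp_all add: s)
    moreover have "eval2 s t (subst2 (phi_B n) (half * (indet_y - 1))) = word_sum n (2 * Suc k + 1)"
      by (rule B) (simp add: t)
    moreover have "eval2 s t (subst2 (phi_A n) (half * (indet_x * indet_y)))
        = word_sum n (2 * (Suc j * (2 * Suc k + 1)))"
      by (rule A) (simp_all only: xy st, simp)
    ultimately show "eval2 s t (subst2 (phi_A n) (half * indet_x) * subst2 (phi_B n) (half * (indet_y - 1)))
        = eval2 s t (subst2 (phi_A n) (half * (indet_x * indet_y)))"
      by (simp only: eval2_mult word_sum_mult mult.assoc)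
  qed
  moreover have "subst2 (phi_B n) (half * (indet_x - 1)) * subst2 (phi_A n) (half * indet_y)
      = subst2 (phi_A n) (half * (indet_x * indet_y))"
  \<comment> \<open>The parities are exchanged: now \<open>x\<close> takes odd and \<open>y\<close>
    even values.\<close>
  proof (rule eval2_eqI[OF infinite_range_of_nat[of 1] infinite_range_of_nat[of 0]])
    fix s t assume "s \<in> ?odd" "t \<in> ?even"
    then obtain j k where s: "s = 2 * of_nat (Suc j) + 1" and t: "t = 2 * of_nat (Suc k)" by auto
    have st: "s * t = 2 * of_nat ((2 * Suc j + 1) * Suc k)" by (simp add: s t algebra_simps)
    have "eval2 s t (subst2 (phi_B n) (half * (indet_x - 1))) = word_sum n (2 * Suc j + 1)"
      by (rule B) (simp add: s)
    moreover have "eval2 s t (subst2 (phi_A n) (half * indet_y)) = word_sum n (2 * Suc k)"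
      by (rule A) (simp_all add: t)
    moreover have "eval2 s t (subst2 (phi_A n) (half * (indet_x * indet_y)))
        = word_sum n (2 * ((2 * Suc j + 1) * Suc k))"
      by (rule A) (simp_all only: xy st, simp)
    ultimately show "eval2 s t (subst2 (phi_B n) (half * (indet_x - 1)) * subst2 (phi_A n) (half * indet_y))
        = eval2 s t (subst2 (phi_A n) (half * (indet_x * indet_y)))"
      by (simp only: eval2_mult word_sum_mult mult.left_commute)
  qed
  ultimately show ?thesis ..
qed

end
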